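(* Let $p_1,\dots,p_K \in [0,1]$ with $\sum_{i=1}^K p_i = S$, $S$ a positive integer. Denote by $\mathbb{P}$ the probability measure on subsets of $\mathbb{K} := \{1,\dots,K\}$ corresponding to the Poisson sampling model and by $\mathbb{P}_S$ the probability measure corresponding to the rejective sampling model, both with the same probabilities $p_1,\dots,p_K$. Let $f : \mathcal{P}(\mathbb{K}) \to \{0,1\}$ be such that for all $I, J \in \mathcal{P}(\mathbb{K})$ \[ f(I) \leq f(J) \quad \text{if} \quad I \subseteq J. \] Then, with $I \subseteq \mathbb{K}$ denoting the random support, \[ \mathbb{P}_S\big( f(I) = 1 \big) \leq 2\, \mathbb{P}\big( f(I) = 1 \big). \]
   Context: $\mathcal{P}(\mathbb{K})$ is the power set of $\mathbb{K}$. Poisson sampling model: let $\delta_1,\dots,\delta_K$ be independent Bernoulli $0$-$1$ random variables with $\mathbb{E}\,\delta_j = p_j$; the random support is $\{i : \delta_i = 1\}$, so $\mathbb{P}(I) = \prod_{i\in I} p_i \prod_{j \notin I}(1-p_j)$ for $I \subseteq \mathbb{K}$. Rejective sampling model: the support $I$ is drawn from the Poisson sampling model conditioned on $|I| = S$, i.e. $\mathbb{P}_S(I) := \mathbb{P}(I \mid |I| = S)$. *)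

theory Defs
  imports "HOL-Probability.Probability"
begin

text \<open>
  Law of the random support of independent Bernoulli indicators with success probabilities
  \<open>p\<close>. The indicators are total functions, equal to \<open>False\<close> off the index set.
\<close>

definition poisson_sampling :: "nat \<Rightarrow> (nat \<Rightarrow> real) \<Rightarrow> nat set pmf" where
  "poisson_sampling K p =
     map_pmf (\<lambda>\<delta>. {i \<in> {1..K}. \<delta> i}) (Pi_pmf {1..K} False (\<lambda>i. bernoulli_pmf (p i)))"

text \<open>
  \<open>cond_pmf\<close> is only meaningful if the conditioning event has positive probability; lemma
  \<open>rejective_sampling_well_defined\<close> below shows that this is so whenever the
  \<open>p\<^sub>i\<close> lie in the unit interval and sum to \<open>S\<close>.
\<close>

definition rejective_sampling :: "nat \<Rightarrow> (nat \<Rightarrow> real) \<Rightarrow> nat \<Rightarrow> nat set pmf" where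
  "rejective_sampling K p S = cond_pmf (poisson_sampling K p) {I. card I = S}"

lemma pmf_poisson_sampling:
  assumes "\<And>i. i \<in> {1..K} \<Longrightarrow> p i \<in> {0..1}" and I: "I \<subseteq> {1..K}"
  shows "pmf (poisson_sampling K p) I = (\<Prod>i\<in>I. p i) * (\<Prod>i\<in>{1..K} - I. 1 - p i)"
proof -
  let ?Q = "Pi_pmf {1..K} False (\<lambda>i. bernoulli_pmf (p i))"
  have "pmf (poisson_sampling K p) I = measure_pmf.prob ?Q ((\<lambda>\<delta>. {i \<in> {1..K}. \<delta> i}) -` {I})"
    by (simp add: poisson_sampling_def pmf_map)
  also have "\<dots> = measure_pmf.prob ?Q {\<lambda>i. i \<in> I}"
  proof (rule measure_pmf.finite_measure_eq_AE)
    have "((\<delta> \<in> (\<lambda>\<delta>. {i \<in> {1..K}. \<delta> i}) -` {I}) = (\<delta> \<in> {\<lambda>i. i \<in> I}))"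
      if "\<delta> \<in> set_pmf ?Q" for \<delta>
    proof -
      have "\<forall>i. i \<notin> {1..K} \<longrightarrow> \<not> \<delta> i"
        using that set_Pi_pmf_subset[of "{1..K}" False "\<lambda>i. bernoulli_pmf (p i)"] by blast
      then show ?thesis using I by (auto simp: fun_eq_iff)
    qed
    then show "AE \<delta> in ?Q. (\<delta> \<in> (\<lambda>\<delta>. {i \<in> {1..K}. \<delta> i}) -` {I}) = (\<delta> \<in> {\<lambda>i. i \<in> I})"
      by (simp add: AE_measure_pmf_iff)
  qed auto
  also have "\<dots> = pmf ?Q (\<lambda>i. i \<in> I)"
    by (simp add: measure_pmf_single)
  also have "\<dots> = (\<Prod>i\<in>{1..K}. pmf (bernoulli_pmf (p i)) (i \<in> I))"
    using I by (subst pmf_Pi') auto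
  also have "\<dots> = (\<Prod>i\<in>{1..K}. if i \<in> I then p i else 1 - p i)"
    using assms(1) by (intro prod.cong) auto
  also have "\<dots> = (\<Prod>i\<in>I. p i) * (\<Prod>i\<in>{1..K} - I. 1 - p i)"
    using I by (simp add: prod.If_cases Int_absorb1 Diff_eq)
  finally show ?thesis .
qed

lemma rejective_sampling_well_defined:
  fixes p :: "nat \<Rightarrow> real"
  assumes p: "\<And>i. i \<in> {1..K} \<Longrightarrow> p i \<in> {0..1}" and sum: "(\<Sum>i=1..K. p i) = real S"
  shows "set_pmf (poisson_sampling K p) \<inter> {I. card I = S} \<noteq> {}"
proof -
  define A where "A = {i \<in> {1..K}. p i = 1}"
  define B where "B = {i \<in> {1..K}. p i \<noteq> 0}"
  have sub: "A \<subseteq> B" "B \<subseteq> {1..K}" and fin: "finite A" "finite B"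
    by (auto simp: A_def B_def)
  have "real (card A) = (\<Sum>i\<in>A. p i)" by (simp add: A_def)
  also have "\<dots> \<le> (\<Sum>i=1..K. p i)"
    using p by (intro sum_mono2) (auto simp: A_def)
  finally have A: "card A \<le> S" using sum by simp
  have "(\<Sum>i=1..K. p i) = (\<Sum>i\<in>B. p i)"
    by (intro sum.mono_neutral_right) (auto simp: B_def)
  also have "\<dots> \<le> (\<Sum>i\<in>B. 1)"
    using p by (intro sum_mono) (auto simp: B_def)
  finally have B: "S \<le> card B" using sum by simp
  obtain I where I: "A \<subseteq> I" "I \<subseteq> B" "card I = S"
    using exists_subset_between[OF A B sub(1) fin(2)] by blast
  have "pmf (poisson_sampling K p) I \<noteq> 0"
    using I sub finite_subset[OF I(2) fin(2)]
    by (subst pmf_poisson_sampling[OF p]) (auto simp: A_def B_def)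
  then show ?thesis using I(3) by (auto simp: set_pmf_iff)
qed

lemma pmf_rejective_sampling:
  fixes p :: "nat \<Rightarrow> real"
  assumes "\<And>i. i \<in> {1..K} \<Longrightarrow> p i \<in> {0..1}" and "(\<Sum>i=1..K. p i) = real S"
  shows "pmf (rejective_sampling K p S) I =
    (if card I = S
     then pmf (poisson_sampling K p) I / measure_pmf.prob (poisson_sampling K p) {J. card J = S}
     else 0)"
  unfolding rejective_sampling_def
  using pmf_cond[OF rejective_sampling_well_defined[OF assms]] by simp

end

theory Submission
  imports Defs
begin

text \<open>
  Conditioning on a larger cardinality makes an increasing event more likely, because two
  independent supports \<open>I\<close>, \<open>J\<close> with \<open>card I \<le> card J\<close> can exchange
  their cardinalities by moving a set \<open>T \<subseteq> J - I\<close> from \<open>J\<close> to \<open>I\<close>,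
  which preserves the product of their probabilities. Hence the claim follows with constant
  \<open>1 / P (card I \<ge> S)\<close>, and it remains to see that the cardinality, a sum of independent
  Bernoulli variables with integer mean \<open>S\<close>, is at least \<open>S\<close> with probability at
  least \<open>1 / 2\<close>. By Hoeffding's argument, among all \<open>p\<close> with the same sum the worst
  case is attained when all \<open>p\<^sub>i\<close> different from \<open>0\<close> and \<open>1\<close> coincide,
  which leaves the binomial distribution with integer mean.
\<close>

section \<open>Weights of supports and the exchange argument\<close>

text \<open>Probability of the support \<open>I\<close>, written as one product over
  \<open>V\<close>: only \<open>I \<inter> V\<close> matters, and moving elements between two sets
  can be checked factor by factor.\<close>

definition weight :: "'a set \<Rightarrow> ('a \<Rightarrow> real) \<Rightarrow> 'a set \<Rightarrow> real" where
  "weight V p I = (\<Prod>i\<in>V. if i \<in> I then p i else 1 - p i)"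

lemma weight_nonneg:
  assumes "\<And>i. i \<in> V \<Longrightarrow> p i \<in> {0..1}"
  shows "0 \<le> weight V p I"
  unfolding weight_def using assms by (intro prod_nonneg) auto

text \<open>At an index of \<open>T\<close> the two factors trade places; elsewhere both are
  unchanged.\<close>

lemma weight_mult_swap:
  assumes "T \<subseteq> J - I"
  shows "weight V p (J - T) * weight V p (I \<union> T) = weight V p I * weight V p J"
  unfolding weight_def prod.distrib[symmetric]
  using assms by (intro prod.cong) auto

text \<open>Divided by the two sums without \<open>P\<close>, this compares conditioning on size
  \<open>k\<close> with conditioning on size at least \<open>k\<close>; the product form avoids any
  question of zero denominators.\<close>

lemma weight_exchange:
  assumes fin: "finite V" and p: "\<And>i. i \<in> V \<Longrightarrow> p i \<in> {0..1}"
    and mono: "\<And>I J. I \<subseteq> J \<Longrightarrow> J \<subseteq> V \<Longrightarrow> P I \<Longrightarrow> P J"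
  shows "(\<Sum>I | I \<subseteq> V \<and> card I = k \<and> P I. weight V p I) * (\<Sum>J | J \<subseteq> V \<and> k \<le> card J. weight V p J)
    \<le> (\<Sum>I | I \<subseteq> V \<and> card I = k. weight V p I) * (\<Sum>J | J \<subseteq> V \<and> k \<le> card J \<and> P J. weight V p J)"
proof -
  define A where "A = {I. I \<subseteq> V \<and> card I = k}"
  define B where "B = {J. J \<subseteq> V \<and> k \<le> card J}"
  \<comment> \<open>The map \<open>\<phi>\<close> is an involution of \<open>X\<close>; it preserves \<open>card J\<close> and
    \<open>card (J - I)\<close>, hence the number \<open>N I J\<close> of admissible \<open>T\<close>.\<close>
  define X where "X = Sigma (A \<times> B) (\<lambda>(I, J). {T. T \<subseteq> J - I \<and> card T = card J - k})"
  define N where "N = (\<lambda>I J :: 'a set. card (J - I) choose (card J - k))"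
  \<comment> \<open>The mass of a pair is shared equally among its \<open>N I J\<close> sets
    \<open>T\<close>; summing over \<open>T\<close> restores it, which is
    \<open>expand\<close>.\<close>
  define g where "g = (\<lambda>I J. weight V p I * weight V p J / real (N I J))"
  define \<phi> where "\<phi> = (\<lambda>((I, J), T). ((J - T, I \<union> T), T :: 'a set))"
  have finV: "finite I" if "I \<subseteq> V" for I using that fin finite_subset by blast
  have finA: "finite A" and finB: "finite B" using fin by (auto simp: A_def B_def)
  have diff: "card I + card (J - I) = card J + card (I - J)" if "I \<subseteq> V" "J \<subseteq> V" for I J
    using card_Un_disjoint[of I "J - I"] card_Un_disjoint[of J "I - J"] finV[OF that(1)] finV[OF that(2)]
    by (auto simp: Un_commute)
  \<comment> \<open>As \<open>card I = k\<close>, \<open>diff\<close> gives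
    \<open>card J - k \<le> card (J - I)\<close>, so an admissible \<open>T\<close> exists and
    \<open>g\<close> divides by a positive number.\<close>
  have Npos: "0 < N I J" if "I \<in> A" "J \<in> B" for I J
    using diff[of I J] that by (auto simp: N_def A_def B_def zero_less_binomial_iff)
  have expand: "(\<Sum>(I, J)\<in>A \<times> B. c I J * (weight V p I * weight V p J)) = (\<Sum>((I, J), T)\<in>X. c I J * g I J)"
    for c :: "'a set \<Rightarrow> 'a set \<Rightarrow> real"
  proof -
    have "(\<Sum>((I, J), T)\<in>X. c I J * g I J)
        = (\<Sum>z\<in>A \<times> B. \<Sum>T\<in>(case z of (I, J) \<Rightarrow> {T. T \<subseteq> J - I \<and> card T = card J - k}). case z of (I, J) \<Rightarrow> c I J * g I J)"
      unfolding X_def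
      by (subst sum.Sigma) (use finA finB finV in \<open>auto simp: B_def intro!: sum.cong\<close>)
    also have "\<dots> = (\<Sum>(I, J)\<in>A \<times> B. c I J * (weight V p I * weight V p J))"
    proof (intro sum.cong refl, clarify)
      fix I J assume IJ: "I \<in> A" "J \<in> B"
      then have "card {T. T \<subseteq> J - I \<and> card T = card J - k} = N I J"
        using finV[of J] by (auto simp: N_def B_def n_subsets)
      then show "(\<Sum>T\<in>{T. T \<subseteq> J - I \<and> card T = card J - k}. c I J * g I J)
          = c I J * (weight V p I * weight V p J)"
        using Npos[OF IJ] by (simp add: g_def)
    qed
    finally show ?thesis by simp
  qed
  have \<phi>_X: "\<phi> z \<in> X" and \<phi>_inv: "\<phi> (\<phi> z) = z"
    and \<phi>_g: "(case \<phi> z of ((I, J), T) \<Rightarrow> g I J) = (case z of ((I, J), T) \<Rightarrow> g I J)" if "z \<in> X" for z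
  proof -
    obtain I J T where z: "z = ((I, J), T)" by (metis surj_pair)
    have IJ: "I \<subseteq> V" "card I = k" "J \<subseteq> V" "k \<le> card J" and T: "T \<subseteq> J - I" "card T = card J - k"
      using that by (auto simp: z X_def A_def B_def)
    have f: "finite I" "finite J" "finite T"
      using IJ T finV by (auto intro: finite_subset)
    have c1: "card (J - T) = k"
      using T IJ f by (subst card_Diff_subset) auto
    have c2: "card (I \<union> T) = card J"
      using T IJ f by (subst card_Un_disjoint) auto
    have "(I \<union> T) - (J - T) = (I - J) \<union> T" using T by auto
    moreover have "card ((I - J) \<union> T) = card (I - J) + card T"
      using T f by (intro card_Un_disjoint) auto
    ultimately have c3: "card ((I \<union> T) - (J - T)) = card (J - I)"
      using diff[of I J] IJ T by auto
    show "\<phi> z \<in> X"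
      using IJ T c1 c2 by (auto simp: z \<phi>_def X_def A_def B_def)
    show "\<phi> (\<phi> z) = z" using T by (auto simp: z \<phi>_def)
    show "(case \<phi> z of ((I, J), T) \<Rightarrow> g I J) = (case z of ((I, J), T) \<Rightarrow> g I J)"
      unfolding z \<phi>_def g_def N_def using weight_mult_swap[OF T(1)] c2 c3 by simp
  qed
  have split: "(\<Sum>I | I \<subseteq> V \<and> card I = k \<and> P I. weight V p I) = (\<Sum>I\<in>A. of_bool (P I) * weight V p I)"
    "(\<Sum>J | J \<subseteq> V \<and> k \<le> card J \<and> P J. weight V p J) = (\<Sum>J\<in>B. of_bool (P J) * weight V p J)"
    using finA finB by (auto simp: A_def B_def intro!: sum.mono_neutral_cong_left)
  have "(\<Sum>I\<in>A. of_bool (P I) * weight V p I) * (\<Sum>J\<in>B. weight V p J)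
      = (\<Sum>(I, J)\<in>A \<times> B. of_bool (P I) * (weight V p I * weight V p J))"
    by (simp add: sum_product sum.cartesian_product mult.assoc)
  also have "\<dots> = (\<Sum>((I, J), T)\<in>X. of_bool (P I) * g I J)"
    by (rule expand)
  \<comment> \<open>The only inequality of the chain: monotonicity passes from \<open>I\<close> to
    \<open>I \<union> T\<close>.\<close>
  also have "\<dots> \<le> (\<Sum>((I, J), T)\<in>X. of_bool (P (I \<union> T)) * g I J)"
  proof (intro sum_mono, clarify)
    fix I J T assume "((I, J), T) \<in> X"
    then have "I \<union> T \<subseteq> V" by (auto simp: X_def A_def B_def)
    then have "P I \<Longrightarrow> P (I \<union> T)" using mono[of I "I \<union> T"] by auto
    moreover have "0 \<le> g I J" by (simp add: g_def weight_nonneg[OF p])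
    ultimately show "of_bool (P I) * g I J \<le> of_bool (P (I \<union> T)) * g I J" by auto
  qed
  \<comment> \<open>\<open>I \<union> T\<close> is the second set of \<open>\<phi> z\<close> and
    \<open>g\<close> is invariant under \<open>\<phi>\<close>, so the sum can be reindexed along
    this involution.\<close>
  also have "\<dots> = (\<Sum>z\<in>X. case \<phi> z of ((I, J), T) \<Rightarrow> of_bool (P J) * g I J)"
  proof (intro sum.cong refl)
    fix z assume z: "z \<in> X"
    show "(\<lambda>((I, J), T). of_bool (P (I \<union> T)) * g I J) z
        = (case \<phi> z of ((I, J), T) \<Rightarrow> of_bool (P J) * g I J)"
      using \<phi>_g[OF z] by (auto simp: \<phi>_def split: prod.splits)
  qed
  also have "\<dots> = (\<Sum>((I, J), T)\<in>X. of_bool (P J) * g I J)"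
    by (rule sum.reindex_bij_witness[where i = \<phi> and j = \<phi>]) (use \<phi>_X \<phi>_inv in \<open>auto split: prod.splits\<close>)
  also have "\<dots> = (\<Sum>(I, J)\<in>A \<times> B. of_bool (P J) * (weight V p I * weight V p J))"
    by (rule expand[symmetric])
  also have "\<dots> = (\<Sum>I\<in>A. weight V p I) * (\<Sum>J\<in>B. of_bool (P J) * weight V p J)"
    by (simp add: sum_product sum.cartesian_product algebra_simps)
  finally show ?thesis
    unfolding split unfolding A_def B_def .
qed

section \<open>Binomial lower tail at an integer mean\<close>

text \<open>
  The differences \<open>d j = q (m + j) - q (m - 1 - j)\<close> start nonnegative and change sign at most
  once. The mean being \<open>m\<close> gives \<open>(\<Sum>j. j * d j) \<ge> 0\<close>, so if the sign changes at
  \<open>j\<^sub>0\<close>, then \<open>j\<^sub>0 * (\<Sum>j. d j) \<ge> (\<Sum>j. j * d j) \<ge> 0\<close>.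
\<close>

lemma binomial_tail_integer_mean:
  fixes a :: real and m n :: nat
  assumes a: "0 < a" "a < 1" and mean: "real n * a = real m"
  shows "(\<Sum>k<m. real (n choose k) * a ^ k * (1 - a) ^ (n - k)) \<le> 1 / 2"
proof (cases "m = 0")
  case False
  define q where "q = (\<lambda>k. real (n choose k) * a ^ k * (1 - a) ^ (n - k))"
  have mn: "m < n"
  proof -
    have "0 < real n" using False mean by (cases n) auto
    then have "real n * a < real n * 1" using a by (intro mult_strict_left_mono) auto
    then show ?thesis using mean by simp
  qed
  have q0: "0 \<le> q k" for k using a by (simp add: q_def)
  have qpos: "0 < q k" if "k \<le> n" for k using a that by (simp add: q_def)
  have qz: "q k = 0" if "n < k" for k using that by (simp add: q_def)
  have le_n: "k \<le> n" if "q k \<noteq> 0" for k using qz that by (meson not_le)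
  \<comment> \<open>Ratio of consecutive binomial probabilities, cleared of denominators; from
    \<open>k = n\<close> on both sides vanish, so it holds for every \<open>k\<close>.\<close>
  have rec0: "real (Suc k) * (1 - a) * q (Suc k) = (real n - real k) * a * q k" for k
  proof (cases "k < n")
    case True
    have "real (Suc k) * real (n choose Suc k) = real (n - k) * real (n choose k)"
      using binomial_absorb_comp[of n k] binomial_absorption[of k n] True
      by (metis of_nat_mult mult.commute binomial_absorption binomial_absorb_comp)
    moreover have "(1 - a) ^ (n - k) = (1 - a) * (1 - a) ^ (n - Suc k)"
      using True by (metis Suc_diff_Suc power_Suc)
    ultimately show ?thesis using True
      by (simp add: q_def of_nat_diff)
  next
    case False
    then show ?thesis by (cases "k = n") (auto simp: qz)
  qed
  \<comment> \<open>Multiplying by \<open>n\<close> and using \<open>n * a = m\<close>,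
    \<open>n * (1 - a) = n - m\<close> eliminates \<open>a\<close>.\<close>
  have rec: "real (Suc k) * (real n - real m) * q (Suc k) = (real n - real k) * real m * q k" for k
  proof -
    have "real n * (real (Suc k) * (1 - a) * q (Suc k)) = real n * ((real n - real k) * a * q k)"
      by (simp only: rec0)
    then show ?thesis using mean[symmetric] by (simp add: algebra_simps)
  qed
  have total: "(\<Sum>k\<le>n. q k) = 1"
    using binomial_ring[of a "1 - a" n] by (simp add: q_def)
  have expect: "(\<Sum>k\<le>n. real k * q k) = real m"
  proof -
    obtain n' where n': "n = Suc n'" using mn by (cases n) auto
    have "(\<Sum>k\<le>n. real k * q k) = (\<Sum>k\<le>n'. real (Suc k) * q (Suc k))"
      unfolding n' by (subst sum.atMost_Suc_shift) simp
    also have "\<dots> = (\<Sum>k\<le>n'. real n * a * (real (n' choose k) * a ^ k * (1 - a) ^ (n' - k)))"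
    proof (intro sum.cong refl)
      fix k
      have "real (Suc k) * real (n choose Suc k) = real n * real (n' choose k)"
        unfolding n' by (metis Suc_times_binomial_eq of_nat_mult mult.commute)
      then show "real (Suc k) * q (Suc k) = real n * a * (real (n' choose k) * a ^ k * (1 - a) ^ (n' - k))"
        by (simp add: q_def n')
    qed
    also have "\<dots> = real n * a"
      using binomial_ring[of a "1 - a" n'] by (simp add: sum_distrib_left[symmetric])
    finally show ?thesis using mean by simp
  qed
  define d where "d = (\<lambda>j. q (m + j) - q (m - 1 - j))"
  have low: "(\<Sum>k<m. c k * q k) = (\<Sum>j<m. c (m - 1 - j) * q (m - 1 - j))" for c
    by (rule sum.reindex_bij_witness[where i = "\<lambda>j. m - 1 - j" and j = "\<lambda>j. m - 1 - j"]) auto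
  have high: "(\<Sum>k\<le>n. c k * q k) = (\<Sum>k<m. c k * q k) + (\<Sum>k=m..n. c k * q k)" for c
  proof -
    have "{..n} = {..<m} \<union> {m..n}" using mn by auto
    then show ?thesis by (simp add: sum.union_disjoint ivl_disj_int)
  qed
  \<comment> \<open>The range \<open>m..<2*m\<close> may overshoot \<open>n\<close>, where
    \<open>q\<close> vanishes, or stop short of it; hence only an inequality.\<close>
  have high_le: "(\<Sum>j<m. q (m + j)) \<le> (\<Sum>k=m..n. q k)"
  proof -
    have "(\<Sum>j<m. q (m + j)) = (\<Sum>k=m..<2*m. q k)"
      by (rule sum.reindex_bij_witness[where i = "\<lambda>k. k - m" and j = "\<lambda>j. m + j"]) auto
    also have "\<dots> = (\<Sum>k\<in>{m..<2*m} \<inter> {m..n}. q k)"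
      by (rule sum.mono_neutral_right) (auto dest: le_n)
    also have "\<dots> \<le> (\<Sum>k=m..n. q k)"
      by (intro sum_mono2) (auto simp: q0)
    finally show ?thesis .
  qed
  \<comment> \<open>The recursion at \<open>m - 1\<close> has the factor \<open>n - m\<close> on one
    side and the larger \<open>n - m + 1\<close> on the other.\<close>
  have d0: "0 \<le> d 0"
  proof -
    have "real m * (real n - real m) * q m = (real n - real m + 1) * real m * q (m - 1)"
      using rec[of "m - 1"] False by (simp add: of_nat_diff)
    then have "real m * ((real n - real m) * q m) = real m * ((real n - real m) * q (m - 1) + q (m - 1))"
      by (simp only: distrib_right distrib_left mult_ac mult_1_left)
    then have "(real n - real m) * q m = (real n - real m) * q (m - 1) + q (m - 1)"
      using False by simp
    then have "(real n - real m) * q (m - 1) \<le> (real n - real m) * q m" using q0 by simp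
    then show ?thesis using mn by (simp add: d_def)
  qed
  \<comment> \<open>Product of the recursion at \<open>m + j - 1\<close> and at
    \<open>m - 1 - j\<close>. It relates the ratio \<open>q (m + j) / q (m - 1 - j)\<close>, whose
    comparison with 1 decides the sign of \<open>d j\<close>, to the same ratio at
    \<open>j - 1\<close>.\<close>
  have step_eq: "(real m ^ 2 - real j ^ 2) * (real n - real m) ^ 2 * (q (m + j) * q (m - j))
      = ((real n - real m + 1) ^ 2 - real j ^ 2) * real m ^ 2 * (q (m + (j - 1)) * q (m - 1 - j))"
    if "1 \<le> j" "j < m" for j
  proof -
    obtain i where i: "j = Suc i" using \<open>1 \<le> j\<close> by (cases j) auto
    have "real (m + j) * (real n - real m) * q (m + j) = (real n - real m + 1 - real j) * real m * q (m + (j - 1))"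
      using rec[of "m + i"] by (simp add: i algebra_simps)
    moreover have "(real m - real j) * (real n - real m) * q (m - j)
        = (real n - real m + 1 + real j) * real m * q (m - 1 - j)"
    proof -
      have "Suc (m - 1 - j) = m - j" using that by simp
      moreover have "real (m - 1 - j) = real m - 1 - real j" using that by (simp add: of_nat_diff)
      moreover have "real (m - j) = real m - real j" using that by (simp add: of_nat_diff)
      ultimately show ?thesis using rec[of "m - 1 - j"] by (simp add: algebra_simps)
    qed
    ultimately have "(real (m + j) * (real n - real m) * q (m + j)) * ((real m - real j) * (real n - real m) * q (m - j))
       = ((real n - real m + 1 - real j) * real m * q (m + (j - 1))) * ((real n - real m + 1 + real j) * real m * q (m - 1 - j))"
      by simp
    then show ?thesis by (simp add: power2_eq_square algebra_simps)
  qed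
  have "0 \<le> (\<Sum>j<m. d j)"
  proof (cases "\<forall>j<m. 0 \<le> d j")
    case True
    then show ?thesis by (intro sum_nonneg) auto
  next
    case neg: False
    define j where "j = (LEAST j. j < m \<and> d j < 0)"
    have "\<exists>j. j < m \<and> d j < 0" using neg by (auto simp: not_le)
    then have j: "j < m" "d j < 0" using LeastI_ex[of "\<lambda>j. j < m \<and> d j < 0"] by (auto simp: j_def)
    have below: "0 \<le> d i" if "i < j" for i
      using not_less_Least[of i "\<lambda>j. j < m \<and> d j < 0"] that j by (fastforce simp: j_def)
    have j1: "1 \<le> j" using d0 j by (cases j) auto
    let ?Q = "q (m + (j - 1)) * q (m - 1 - j)"
    have idx: "m - 1 - (j - 1) = m - j" using j1 by simp
    have qj: "q (m - j) \<le> q (m + (j - 1))" using below[of "j - 1"] j1 by (simp add: d_def)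
    have qj': "q (m + j) \<le> q (m - 1 - j)" using j by (simp add: d_def)
    have Qpos: "0 < ?Q"
      using qpos[of "m - 1 - j"] less_le_trans[OF qpos[of "m - j"] qj] mn by (intro mult_pos_pos) auto
    have Q_ge: "q (m + j) * q (m - j) \<le> ?Q"
      using mult_mono[OF qj' qj q0 q0] by (simp only: mult.commute)
    \<comment> \<open>At the first sign change the product on the left of \<open>step_eq\<close> is
      at most \<open>?Q\<close>, so the coefficients compare the other way round.\<close>
    have "((real n - real m + 1)\<^sup>2 - (real j)\<^sup>2) * (real m)\<^sup>2 * ?Q
        \<le> ((real m)\<^sup>2 - (real j)\<^sup>2) * (real n - real m)\<^sup>2 * ?Q"
      unfolding step_eq[OF j1 j(1), symmetric]
      using Q_ge j by (intro mult_left_mono mult_nonneg_nonneg) simp_all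
    then have key: "((real n - real m + 1)\<^sup>2 - (real j)\<^sup>2) * (real m)\<^sup>2 \<le> ((real m)\<^sup>2 - (real j)\<^sup>2) * (real n - real m)\<^sup>2"
      using Qpos by (simp only: mult_le_cancel_right_pos)
    \<comment> \<open>The left side is positive, which forces \<open>n - m < m\<close>. The right
      side then grows with \<open>j\<close>, so the comparison persists for all later indices
      (\<open>key_i\<close>) and the sign cannot change back.\<close>
    then have key': "(real m)\<^sup>2 * ((real n - real m + 1)\<^sup>2 - (real n - real m)\<^sup>2)
        \<le> (real j)\<^sup>2 * ((real m)\<^sup>2 - (real n - real m)\<^sup>2)"
      by (simp add: algebra_simps)
    have "(real n - real m + 1)\<^sup>2 - (real n - real m)\<^sup>2 = 2 * (real n - real m) + 1"
      by (simp add: power2_eq_square algebra_simps)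
    then have "0 < (real m)\<^sup>2 * ((real n - real m + 1)\<^sup>2 - (real n - real m)\<^sup>2)"
      using mn False by simp
    then have pos: "0 < (real m)\<^sup>2 - (real n - real m)\<^sup>2"
      using key' by (smt (verit) zero_le_power2 mult_nonneg_nonpos)
    then have "real n - real m < real m"
      by (simp add: power_less_imp_less_base)
    then have n2m: "n < 2 * m" by linarith
    have key_i: "((real n - real m + 1)\<^sup>2 - (real i)\<^sup>2) * (real m)\<^sup>2 \<le> ((real m)\<^sup>2 - (real i)\<^sup>2) * (real n - real m)\<^sup>2"
      if "j \<le> i" for i
    proof -
      have "(real j)\<^sup>2 * ((real m)\<^sup>2 - (real n - real m)\<^sup>2) \<le> (real i)\<^sup>2 * ((real m)\<^sup>2 - (real n - real m)\<^sup>2)"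
        using that pos by (intro mult_right_mono power_mono) auto
      then show ?thesis using key' by (simp add: algebra_simps)
    qed
    have above: "d i \<le> 0" if "j \<le> i" "i < m" for i
      using that
    proof (induction i rule: dec_induct)
      case base
      then show ?case using j by simp
    next
      case (step i)
      let ?i = "Suc i"
      have prev: "q (m + i) \<le> q (m - ?i)"
        using step by (simp add: d_def)
      show ?case
      \<comment> \<open>Beyond \<open>n\<close> the upper term is zero; otherwise
        \<open>key_i\<close> and the induction hypothesis bound the product, and the positive factor
        \<open>q (m - ?i)\<close> cancels.\<close>
      proof (cases "n < m + ?i")
        case True
        then show ?thesis using q0 by (simp add: d_def qz)
      next
        case le: False
        have c: "0 < ((real m)\<^sup>2 - (real ?i)\<^sup>2) * (real n - real m)\<^sup>2"
        proof -
          have "(real ?i)\<^sup>2 < (real m)\<^sup>2" using step by (intro power_strict_mono) auto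
          then show ?thesis using mn by simp
        qed
        have "((real m)\<^sup>2 - (real ?i)\<^sup>2) * (real n - real m)\<^sup>2 * (q (m + ?i) * q (m - ?i))
          = ((real n - real m + 1)\<^sup>2 - (real ?i)\<^sup>2) * (real m)\<^sup>2 * (q (m + i) * q (m - 1 - ?i))"
          using step_eq[of ?i] step by simp
        also have "\<dots> \<le> ((real m)\<^sup>2 - (real ?i)\<^sup>2) * (real n - real m)\<^sup>2 * (q (m + i) * q (m - 1 - ?i))"
          using key_i[of ?i] step q0 by (intro mult_right_mono) auto
        also have "\<dots> \<le> ((real m)\<^sup>2 - (real ?i)\<^sup>2) * (real n - real m)\<^sup>2 * (q (m - ?i) * q (m - 1 - ?i))"
          using prev q0 c by (intro mult_left_mono mult_right_mono) auto
        finally have "q (m + ?i) * q (m - ?i) \<le> q (m - 1 - ?i) * q (m - ?i)"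
          using c by (simp only: mult_le_cancel_left_pos mult.commute[of "q (m - ?i)"])
        moreover have "0 < q (m - ?i)" using qpos mn by simp
        ultimately have "q (m + ?i) \<le> q (m - 1 - ?i)" by (simp only: mult_le_cancel_right_pos)
        then show ?thesis by (simp add: d_def)
      qed
    qed
    \<comment> \<open>As \<open>n < 2 * m\<close>, the range \<open>m..<2*m\<close> now covers the
      whole upper part.\<close>
    have high_eq: "(\<Sum>k=m..n. c k * q k) = (\<Sum>j<m. c (m + j) * q (m + j))" for c
    proof -
      have "(\<Sum>j<m. c (m + j) * q (m + j)) = (\<Sum>k=m..<2*m. c k * q k)"
        by (rule sum.reindex_bij_witness[where i = "\<lambda>k. k - m" and j = "\<lambda>j. m + j"]) auto
      also have "\<dots> = (\<Sum>k=m..n. c k * q k)"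
        using n2m by (intro sum.mono_neutral_right) (auto dest: le_n)
      finally show ?thesis by simp
    qed
    have "(\<Sum>k\<le>n. (real k - real m) * q k) = 0"
      using expect total by (simp add: left_diff_distrib sum_subtractf sum_distrib_left[symmetric])
    then have "(\<Sum>j<m. (real (m - 1 - j) - real m) * q (m - 1 - j)) + (\<Sum>j<m. real j * q (m + j)) = 0"
      unfolding high[of "\<lambda>k. real k - real m"] low[of "\<lambda>k. real k - real m"] high_eq[of "\<lambda>k. real k - real m"]
      by simp
    moreover have "(\<Sum>j<m. (real (m - 1 - j) - real m) * q (m - 1 - j)) = (\<Sum>j<m. - real j * q (m - 1 - j) - q (m - 1 - j))"
      by (intro sum.cong refl) (auto simp: of_nat_diff algebra_simps)
    \<comment> \<open>\<open>m - 1 - j\<close> lies \<open>j + 1\<close> below the mean,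
      \<open>m + j\<close> only \<open>j\<close> above it; the surplus 1 produces the nonnegative
      right-hand side.\<close>
    ultimately have "(\<Sum>j<m. real j * d j) = (\<Sum>j<m. q (m - 1 - j))"
      by (simp add: d_def sum_subtractf right_diff_distrib sum_negf)
    then have "0 \<le> (\<Sum>i<m. real i * d i)" using q0 by (simp add: sum_nonneg)
    also have "\<dots> \<le> (\<Sum>i<m. real j * d i)"
    proof (intro sum_mono)
      fix i assume "i \<in> {..<m}"
      then show "real i * d i \<le> real j * d i"
        using below[of i] above[of i]
        by (cases "i < j") (auto intro: mult_right_mono mult_right_mono_neg)
    qed
    finally show ?thesis using j1 by (simp add: sum_distrib_left[symmetric] zero_le_mult_iff)
  qed
  then have "(\<Sum>k<m. q k) \<le> (\<Sum>k=m..n. q k)"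
    using high_le low[of "\<lambda>_. 1"] by (simp add: d_def sum_subtractf)
  then have "(\<Sum>k<m. q k) \<le> 1 / 2"
    using total high[of "\<lambda>_. 1"] by simp
  then show ?thesis by (simp add: q_def)
qed simp

section \<open>Lower tail of the cardinality\<close>

text \<open>The bound \<open>c\<close> is an integer so that the recursion in \<open>lower_tail_insert\<close> needs no case \<open>c = 0\<close>.\<close>

definition lower_tail :: "'a set \<Rightarrow> ('a \<Rightarrow> real) \<Rightarrow> int \<Rightarrow> real" where
  "lower_tail V p c = (\<Sum>I\<in>Pow V. if int (card I) < c then weight V p I else 0)"

lemma weight_insert:
  assumes "finite V" "i \<notin> V" "I \<subseteq> V"
  shows "weight (insert i V) p I = (1 - p i) * weight V p I"
    and "weight (insert i V) p (insert i I) = p i * weight V p I"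
proof -
  show "weight (insert i V) p I = (1 - p i) * weight V p I"
    using assms by (auto simp: weight_def)
  have "weight V p (insert i I) = weight V p I"
    unfolding weight_def using assms by (intro prod.cong) auto
  then show "weight (insert i V) p (insert i I) = p i * weight V p I"
    using assms by (simp add: weight_def)
qed

lemma weight_cong:
  assumes "\<And>i. i \<in> V \<Longrightarrow> p i = q i"
  shows "weight V p I = weight V q I"
  unfolding weight_def using assms by (intro prod.cong) auto

lemma lower_tail_cong:
  assumes "\<And>i. i \<in> V \<Longrightarrow> p i = q i"
  shows "lower_tail V p c = lower_tail V q c"
  unfolding lower_tail_def by (intro sum.cong refl if_cong weight_cong assms)

text \<open>Split the subsets by whether they contain \<open>i\<close>; containing it uses up one
  unit of the threshold.\<close>

lemma lower_tail_insert:
  assumes "finite V" "i \<notin> V"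
  shows "lower_tail (insert i V) p c = (1 - p i) * lower_tail V p c + p i * lower_tail V p (c - 1)"
proof -
  have inj: "inj_on (insert i) (Pow V)"
    using assms by (auto simp: inj_on_def)
  have "lower_tail (insert i V) p c =
      (\<Sum>I\<in>Pow V. if int (card I) < c then weight (insert i V) p I else 0) +
      (\<Sum>I\<in>insert i ` Pow V. if int (card I) < c then weight (insert i V) p I else 0)"
    unfolding lower_tail_def Pow_insert
    using assms by (intro sum.union_disjoint) auto
  also have "(\<Sum>I\<in>Pow V. if int (card I) < c then weight (insert i V) p I else 0) = (1 - p i) * lower_tail V p c"
    unfolding lower_tail_def sum_distrib_left
    using assms by (intro sum.cong) (auto simp: weight_insert)
  also have "(\<Sum>I\<in>insert i ` Pow V. if int (card I) < c then weight (insert i V) p I else 0)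
      = p i * lower_tail V p (c - 1)"
    unfolding lower_tail_def sum_distrib_left sum.reindex[OF inj] o_def
  proof (intro sum.cong refl)
    fix I assume I: "I \<in> Pow V"
    then have "finite I" "i \<notin> I" using assms finite_subset by auto
    then show "(if int (card (insert i I)) < c then weight (insert i V) p (insert i I) else 0)
        = p i * (if int (card I) < c - 1 then weight V p I else 0)"
      using I assms by (auto simp: weight_insert)
  qed
  finally show ?thesis .
qed

text \<open>Only the sum and the product of \<open>p i\<close> and \<open>p j\<close> enter, with
  first and second differences of the tail over \<open>W\<close> as coefficients. With the sum
  fixed, the tail is affine in the product.\<close>

lemma lower_tail_insert2:
  assumes "finite W" "i \<notin> W" "j \<notin> W" "i \<noteq> j"
  shows "lower_tail (insert i (insert j W)) p c = lower_tail W p c - (p i + p j) * (lower_tail W p c - lower_tail W p (c - 1))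
    + p i * p j * (lower_tail W p c - 2 * lower_tail W p (c - 1) + lower_tail W p (c - 2))"
  using assms by (simp add: lower_tail_insert algebra_simps)

section \<open>Hoeffding's extremal argument\<close>

lemma continuous_on_lower_tail:
  fixes V :: "'a set"
  assumes "finite V"
  shows "continuous_on UNIV (\<lambda>p. lower_tail V p c)"
proof -
  have "continuous_on UNIV (\<lambda>p. weight V p I)" for I
  proof -
    have "continuous_on UNIV (\<lambda>p :: 'a \<Rightarrow> real. if i \<in> I then p i else 1 - p i)" for i
      by (cases "i \<in> I") (auto intro: continuous_on_diff)
    then show ?thesis unfolding weight_def by (intro continuous_on_prod)
  qed
  then have "continuous_on UNIV (\<lambda>p. if int (card I) < c then weight V p I else 0)" for I
    by (cases "int (card I) < c") auto
  then show ?thesis unfolding lower_tail_def by (intro continuous_on_sum)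
qed

text \<open>Pinning the coordinates outside \<open>V\<close> to 0 makes the cube a product of
  compact sets over the whole index type, so Tychonoff applies; the sum condition is closed.\<close>

lemma compact_unit_cube_slice:
  fixes V :: "'a set"
  assumes "finite V"
  shows "compact {p :: 'a \<Rightarrow> real. (\<forall>i\<in>V. p i \<in> {0..1}) \<and> (\<forall>i. i \<notin> V \<longrightarrow> p i = 0) \<and> (\<Sum>i\<in>V. p i) = s}"
proof -
  let ?B = "PiE UNIV (\<lambda>i. if i \<in> V then {0..1} else {0 :: real})"
  have "compactin (product_topology (\<lambda>_. euclidean) UNIV) ?B"
    by (subst compactin_PiE) auto
  then have "compact ?B" by (simp add: euclidean_product_topology)
  moreover have "closed {p :: 'a \<Rightarrow> real. (\<Sum>i\<in>V. p i) = s}"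
    by (intro closed_Collect_eq continuous_intros continuous_on_product_coordinates)
  ultimately have "compact (?B \<inter> {p. (\<Sum>i\<in>V. p i) = s})" by (rule compact_Int_closed)
  also have "?B \<inter> {p. (\<Sum>i\<in>V. p i) = s} = {p. (\<forall>i\<in>V. p i \<in> {0..1}) \<and> (\<forall>i. i \<notin> V \<longrightarrow> p i = 0) \<and> (\<Sum>i\<in>V. p i) = s}"
    by (auto simp: PiE_iff split: if_splits)
  finally show ?thesis .
qed

text \<open>
  The witness minimises the sum of squares among the maximisers. For fixed \<open>q i + q j\<close> the tail
  is affine in \<open>q i * q j\<close>; at an interior maximiser with \<open>q i \<noteq> q j\<close> its slope
  \<open>\<gamma>\<close> vanishes, and averaging the two values would decrease the sum of squares.
\<close>

lemma lower_tail_maximiser: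
  fixes V :: "'a set"
  assumes fin: "finite V" and p: "\<And>i. i \<in> V \<Longrightarrow> p i \<in> {0..1}"
  shows "\<exists>q. (\<forall>i\<in>V. q i \<in> {0..1}) \<and> (\<Sum>i\<in>V. q i) = (\<Sum>i\<in>V. p i) \<and> lower_tail V p c \<le> lower_tail V q c \<and>
    (\<forall>i\<in>V. \<forall>j\<in>V. 0 < q i \<and> q i < 1 \<and> 0 < q j \<and> q j < 1 \<longrightarrow> q i = q j)"
proof -
  define C where "C = {q :: 'a \<Rightarrow> real. (\<forall>i\<in>V. q i \<in> {0..1}) \<and> (\<forall>i. i \<notin> V \<longrightarrow> q i = 0) \<and> (\<Sum>i\<in>V. q i) = (\<Sum>i\<in>V. p i)}"
  have C: "compact C" unfolding C_def by (rule compact_unit_cube_slice[OF fin])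
  \<comment> \<open>Cutting \<open>p\<close> off outside \<open>V\<close> puts it into
    \<open>C\<close> without changing its tail.\<close>
  define p0 where "p0 = (\<lambda>i. if i \<in> V then p i else 0)"
  have p0: "p0 \<in> C" using p by (auto simp: C_def p0_def)
  have lower_p0: "lower_tail V p0 c = lower_tail V p c" by (rule lower_tail_cong) (simp add: p0_def)
  obtain r where r: "r \<in> C" "\<And>q. q \<in> C \<Longrightarrow> lower_tail V q c \<le> lower_tail V r c"
    using continuous_attains_sup[OF C, of "\<lambda>q. lower_tail V q c"] p0 continuous_on_lower_tail[OF fin, of c]
      continuous_on_subset by blast
  define M where "M = C \<inter> {q. lower_tail V q c = lower_tail V r c}"
  have "compact M"
    unfolding M_def by (intro compact_Int_closed C closed_Collect_eq continuous_on_lower_tail fin continuous_on_const)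
  moreover have "r \<in> M" using r by (simp add: M_def)
  moreover have "continuous_on M (\<lambda>q. \<Sum>i\<in>V. (q i)\<^sup>2)"
    by (intro continuous_intros continuous_on_subset[OF continuous_on_product_coordinates]) auto
  ultimately obtain q where q: "q \<in> M" "\<And>q'. q' \<in> M \<Longrightarrow> (\<Sum>i\<in>V. (q i)\<^sup>2) \<le> (\<Sum>i\<in>V. (q' i)\<^sup>2)"
    using continuous_attains_inf[of M "\<lambda>q. \<Sum>i\<in>V. (q i)\<^sup>2"] by blast
  have qC: "q \<in> C" and q_max: "\<And>q'. q' \<in> C \<Longrightarrow> lower_tail V q' c \<le> lower_tail V q c"
    using q r by (auto simp: M_def)
  have False if i: "i \<in> V" and j: "j \<in> V" and less: "0 < q i" "q i < q j" "q j < 1" for i j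
  proof -
    define W where "W = V - {i, j}"
    have V: "V = insert i (insert j W)" and W: "finite W" "i \<notin> W" "j \<notin> W" and ij: "i \<noteq> j"
      using i j fin less by (auto simp: W_def)
    define \<gamma> where "\<gamma> = lower_tail W q c - 2 * lower_tail W q (c - 1) + lower_tail W q (c - 2)"
    \<comment> \<open>\<open>q' x\<close> redistributes \<open>q i + q j\<close>: \<open>i\<close>
      receives \<open>x\<close> and \<open>j\<close> the rest.\<close>
    define q' where "q' = (\<lambda>x k. if k = i then x else if k = j then q i + q j - x else q k)"
    have sumV: "(\<Sum>k\<in>V. h k) = h i + h j + (\<Sum>k\<in>W. h k)" for h :: "'a \<Rightarrow> real"
      unfolding V using W ij by simp
    have sumW: "(\<Sum>k\<in>W. h (q' x k)) = (\<Sum>k\<in>W. h (q k))" for h :: "real \<Rightarrow> real" and x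
      using W by (intro sum.cong) (auto simp: q'_def)
    have q'_C: "q' x \<in> C" if "x \<in> {0..1}" "q i + q j - x \<in> {0..1}" for x
    proof -
      have "(\<Sum>k\<in>V. q' x k) = (\<Sum>k\<in>V. q k)"
        using ij sumW[of "\<lambda>x. x"] by (simp add: sumV) (simp add: q'_def)
      then show ?thesis
        using qC that i j by (auto simp: C_def q'_def)
    qed
    have lower_q': "lower_tail V (q' x) c - lower_tail V q c = (x * (q i + q j - x) - q i * q j) * \<gamma>" for x
    proof -
      have "lower_tail W (q' x) c' = lower_tail W q c'" for c'
        using W by (intro lower_tail_cong) (auto simp: q'_def)
      then show ?thesis
        unfolding V lower_tail_insert2[OF W ij] \<gamma>_def using ij by (simp add: q'_def algebra_simps)
    qed
    \<comment> \<open>Averaging raises the product by the square of half the difference, so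
      maximality forces \<open>\<gamma> \<le> 0\<close>.\<close>
    define h where "h = (q i + q j) / 2"
    have h: "h * (q i + q j - h) - q i * q j = ((q j - q i) / 2)\<^sup>2"
      by (simp add: h_def power2_eq_square field_simps)
    have hC: "q' h \<in> C" using less by (intro q'_C) (auto simp: h_def field_simps)
    have "0 < ((q j - q i) / 2)\<^sup>2" using less by simp
    then have "\<gamma> \<le> 0"
      using lower_q'[of h] q_max[OF hC] unfolding h by (smt (verit) mult_pos_pos)
    \<comment> \<open>The largest amount by which both values can move apart within the unit
      interval. This lowers the product, so maximality forces
      \<open>0 \<le> \<gamma>\<close>.\<close>
    define e where "e = min (q i) (1 - q j)"
    have e: "0 < e" using less by (simp add: e_def)
    have "(q i - e) * (q i + q j - (q i - e)) - q i * q j = - e * (q j - q i + e)"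
      by (simp add: algebra_simps)
    moreover have "q' (q i - e) \<in> C" using less by (intro q'_C) (auto simp: e_def min_def)
    ultimately have "- e * (q j - q i + e) * \<gamma> \<le> 0"
      using lower_q'[of "q i - e"] q_max by (metis diff_le_0_iff_le)
    moreover have "0 < e * (q j - q i + e)" using e less by simp
    ultimately have "0 \<le> \<gamma>"
      by (smt (verit) mult_minus_left mult_pos_neg)
    with \<open>\<gamma> \<le> 0\<close> have "lower_tail V (q' h) c = lower_tail V q c" using lower_q'[of h] by simp
    then have "q' h \<in> M" using hC q by (auto simp: M_def)
    then have "(\<Sum>k\<in>V. (q k)\<^sup>2) \<le> (\<Sum>k\<in>V. (q' h k)\<^sup>2)" by (rule q(2))
    then have "(q i)\<^sup>2 + (q j)\<^sup>2 \<le> h\<^sup>2 + (q i + q j - h)\<^sup>2"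
      using ij sumW[of "\<lambda>x. x\<^sup>2"] by (simp add: sumV) (simp add: q'_def)
    then have "(q j - q i)\<^sup>2 \<le> 0"
      by (simp add: h_def power2_eq_square field_simps)
    then show False using less by simp
  qed
  then have "q i = q j" if "i \<in> V" "j \<in> V" "0 < q i" "q i < 1" "0 < q j" "q j < 1" for i j
    using that by (metis linorder_neqE_linordered_idom)
  moreover have "lower_tail V p c \<le> lower_tail V q c" using q_max[OF p0] lower_p0 by simp
  ultimately show ?thesis using qC by (intro exI[of _ q]) (auto simp: C_def)
qed

section \<open>Reduction to the binomial case\<close>

text \<open>An index of value 0 drops out, one of value 1 lowers the threshold by one and is counted
  in \<open>u\<close>, and the others form \<open>A\<close>. The threshold is quantified inside
  because the recursion also visits \<open>c - 1\<close>.\<close>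

lemma lower_tail_two_valued:
  fixes V :: "'a set"
  assumes "finite V" "\<And>i. i \<in> V \<Longrightarrow> q i \<in> {0, a, 1}"
  shows "\<exists>A\<subseteq>V. \<exists>u. (\<Sum>i\<in>V. q i) = real (card A) * a + real u \<and>
    (\<forall>c. lower_tail V q c = lower_tail A (\<lambda>_. a) (c - int u))"
  using assms
proof (induction V)
  case empty
  have "lower_tail {} q c = lower_tail {} (\<lambda>_ :: 'a. a) (c - int 0)" for c
    by simp (rule lower_tail_cong, simp)
  then show ?case by (intro exI[of _ "{}"] conjI exI[of _ 0]) auto
next
  case (insert i V)
  from insert.IH[OF insert.prems] obtain A u
    where A: "A \<subseteq> V" "(\<Sum>i\<in>V. q i) = real (card A) * a + real u"
      and "\<forall>c. lower_tail V q c = lower_tail A (\<lambda>_. a) (c - int u)"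
    by blast
  then have lower_V: "lower_tail V q c = lower_tail A (\<lambda>_. a) (c - int u)" for c by blast
  have fA: "finite A" "i \<notin> A" using A insert finite_subset by auto
  have rec: "lower_tail (insert i V) q c = (1 - q i) * lower_tail A (\<lambda>_. a) (c - int u) + q i * lower_tail A (\<lambda>_. a) (c - 1 - int u)" for c
    using insert.hyps by (simp add: lower_tail_insert lower_V)
  consider "q i = 0" | "q i = 1" | "q i = a" using insert.prems by auto
  then show ?case
  proof cases
    case 1
    then show ?thesis using A insert.hyps rec by (intro exI[of _ A] conjI exI[of _ u]) auto
  next
    case 2
    then show ?thesis using A insert.hyps rec
      by (intro exI[of _ A] conjI exI[of _ "Suc u"]) (auto simp: algebra_simps)
  next
    case 3
    then show ?thesis using A insert.hyps rec fA
      by (intro exI[of _ "insert i A"] conjI exI[of _ u]) (auto simp: algebra_simps lower_tail_insert)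
  qed
qed

text \<open>All sets of size \<open>k\<close> have the same weight; grouping by size gives the
  binomial sum.\<close>

lemma lower_tail_const:
  assumes fin: "finite A"
  shows "lower_tail A (\<lambda>_. a) (int m) = (\<Sum>k<m. real (card A choose k) * a ^ k * (1 - a) ^ (card A - k))"
proof -
  have w: "weight A (\<lambda>_. a) I = a ^ card I * (1 - a) ^ (card A - card I)" if "I \<subseteq> A" for I
    using that fin finite_subset[OF that fin]
    by (simp add: weight_def prod.If_cases Int_absorb1 Diff_eq[symmetric] card_Diff_subset)
  have "lower_tail A (\<lambda>_. a) (int m) = (\<Sum>I | I \<subseteq> A \<and> card I < m. weight A (\<lambda>_. a) I)"
    unfolding lower_tail_def using fin by (intro sum.mono_neutral_cong_right) auto
  also have "\<dots> = (\<Sum>k<m. \<Sum>I\<in>{I \<in> {I. I \<subseteq> A \<and> card I < m}. card I = k}. weight A (\<lambda>_. a) I)"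
    using fin by (intro sum.group[symmetric]) auto
  also have "\<dots> = (\<Sum>k<m. real (card A choose k) * a ^ k * (1 - a) ^ (card A - k))"
  proof (intro sum.cong refl)
    fix k assume k: "k \<in> {..<m}"
    have "(\<Sum>I\<in>{I \<in> {I. I \<subseteq> A \<and> card I < m}. card I = k}. weight A (\<lambda>_. a) I)
        = (\<Sum>I | I \<subseteq> A \<and> card I = k. a ^ k * (1 - a) ^ (card A - k))"
      using k by (intro sum.cong) (auto simp: w)
    then show "(\<Sum>I\<in>{I \<in> {I. I \<subseteq> A \<and> card I < m}. card I = k}. weight A (\<lambda>_. a) I)
        = real (card A choose k) * a ^ k * (1 - a) ^ (card A - k)"
      using fin by (simp add: n_subsets)
  qed
  finally show ?thesis .
qed

text \<open>A maximiser takes only the values \<open>0\<close>, \<open>a\<close>, \<open>1\<close>.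
  Removing zeros and ones shifts mean and threshold alike, so the remaining binomial still has its
  mean at the threshold.\<close>

lemma lower_tail_integer_mean:
  assumes fin: "finite V" and p: "\<And>i. i \<in> V \<Longrightarrow> p i \<in> {0..1}" and mean: "(\<Sum>i\<in>V. p i) = real S"
  shows "lower_tail V p (int S) \<le> 1 / 2"
proof -
  have "\<exists>q. (\<forall>i\<in>V. q i \<in> {0..1}) \<and> (\<Sum>i\<in>V. q i) = (\<Sum>i\<in>V. p i) \<and> lower_tail V p (int S) \<le> lower_tail V q (int S) \<and>
      (\<forall>i\<in>V. \<forall>j\<in>V. 0 < q i \<and> q i < 1 \<and> 0 < q j \<and> q j < 1 \<longrightarrow> q i = q j)"
    using fin p by (rule lower_tail_maximiser)
  then obtain q where q: "\<And>i. i \<in> V \<Longrightarrow> q i \<in> {0..1}" "(\<Sum>i\<in>V. q i) = (\<Sum>i\<in>V. p i)"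
    "lower_tail V p (int S) \<le> lower_tail V q (int S)"
    "\<And>i j. \<lbrakk>i \<in> V; j \<in> V; 0 < q i; q i < 1; 0 < q j; q j < 1\<rbrakk> \<Longrightarrow> q i = q j"
    by blast
  obtain a where a: "0 < a" "a < 1" "\<And>i. i \<in> V \<Longrightarrow> q i \<in> {0, a, 1}"
  proof (cases "\<exists>i\<in>V. 0 < q i \<and> q i < 1")
    case True
    then obtain i where i: "i \<in> V" "0 < q i" "q i < 1" by blast
    then have "q j \<in> {0, q i, 1}" if "j \<in> V" for j
      using q(1)[OF that] q(4)[OF i(1) that] by (auto simp: less_le)
    then show ?thesis using i that by blast
  next
    \<comment> \<open>With no value strictly inside, any \<open>a\<close> between 0 and 1 serves;
      \<open>1 / 2\<close> is an arbitrary choice.\<close>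
    case False
    then have "q j \<in> {0, 1 / 2, 1}" if "j \<in> V" for j
      using q(1)[OF that] that by (auto simp: less_le)
    then show ?thesis using that[of "1 / 2"] by auto
  qed
  obtain A u where A: "A \<subseteq> V" "real S = real (card A) * a + real u"
    "lower_tail V q (int S) = lower_tail A (\<lambda>_. a) (int S - int u)"
    using lower_tail_two_valued[where q = q and a = a, OF fin] a(3) q(2) mean by metis
  have "0 \<le> real (card A) * a" using a by simp
  \<comment> \<open>The ones contribute at most the mean, so the threshold \<open>S - u\<close> is a
    natural number, equal to \<open>card A * a\<close>.\<close>
  then have u: "u \<le> S" using A(2) by linarith
  then have "lower_tail V q (int S) = lower_tail A (\<lambda>_. a) (int (S - u))" using A by (simp add: of_nat_diff)
  also have "\<dots> \<le> 1 / 2"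
    unfolding lower_tail_const[OF finite_subset[OF A(1) fin]]
    using a A(2) u by (intro binomial_tail_integer_mean) (auto simp: of_nat_diff)
  finally show ?thesis using q(3) by simp
qed

section \<open>Transfer to the two sampling models\<close>

lemma prod_eq_weight:
  assumes "finite V" "I \<subseteq> V"
  shows "(\<Prod>i\<in>I. p i) * (\<Prod>i\<in>V - I. 1 - p i) = weight V p I"
  using assms by (simp add: weight_def prod.If_cases Int_absorb1 Diff_eq)

lemma set_pmf_poisson_sampling: "set_pmf (poisson_sampling K p) \<subseteq> Pow {1..K}"
  by (auto simp: poisson_sampling_def)

lemma prob_supported:
  assumes "set_pmf M \<subseteq> A" "finite A"
  shows "measure_pmf.prob M E = (\<Sum>x | x \<in> A \<and> x \<in> E. pmf M x)"
proof -
  have "E \<inter> set_pmf M = {x. x \<in> A \<and> x \<in> E} \<inter> set_pmf M" using assms by auto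
  then have "measure_pmf.prob M E = measure_pmf.prob M {x. x \<in> A \<and> x \<in> E}"
    by (metis measure_Int_set_pmf)
  then show ?thesis using assms by (simp add: measure_measure_pmf_finite)
qed

lemma prob_poisson_sampling:
  assumes "\<And>i. i \<in> {1..K} \<Longrightarrow> p i \<in> {0..1}"
  shows "measure_pmf.prob (poisson_sampling K p) E = (\<Sum>I | I \<subseteq> {1..K} \<and> I \<in> E. weight {1..K} p I)"
proof -
  have "measure_pmf.prob (poisson_sampling K p) E
      = (\<Sum>I | I \<in> Pow {1..K} \<and> I \<in> E. pmf (poisson_sampling K p) I)"
    by (intro prob_supported set_pmf_poisson_sampling) simp
  also have "\<dots> = (\<Sum>I | I \<subseteq> {1..K} \<and> I \<in> E. weight {1..K} p I)"
  proof (intro sum.cong)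
    fix I assume "I \<in> {I. I \<subseteq> {1..K} \<and> I \<in> E}"
    then have I: "I \<subseteq> {1..K}" by simp
    have "pmf (poisson_sampling K p) I = (\<Prod>i\<in>I. p i) * (\<Prod>i\<in>{1..K} - I. 1 - p i)"
      using assms I by (rule pmf_poisson_sampling)
    then show "pmf (poisson_sampling K p) I = weight {1..K} p I"
      using I by (simp only: prod_eq_weight finite_atLeastAtMost)
  qed auto
  finally show ?thesis .
qed

lemma prob_rejective_sampling:
  assumes "\<And>i. i \<in> {1..K} \<Longrightarrow> p i \<in> {0..1}" and "(\<Sum>i=1..K. p i) = real S"
  shows "measure_pmf.prob (rejective_sampling K p S) E =
    measure_pmf.prob (poisson_sampling K p) {I. card I = S \<and> I \<in> E} /
    measure_pmf.prob (poisson_sampling K p) {I. card I = S}"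
proof -
  let ?M = "poisson_sampling K p"
  have pmf: "pmf (rejective_sampling K p S) I =
      (if card I = S then pmf ?M I / measure_pmf.prob ?M {J. card J = S} else 0)" for I
    using assms by (rule pmf_rejective_sampling)
  have "set_pmf ?M \<inter> {I. card I = S} \<noteq> {}"
    using assms by (rule rejective_sampling_well_defined)
  then have "set_pmf (rejective_sampling K p S) \<subseteq> Pow {1..K}"
    using set_pmf_poisson_sampling[of K p] by (auto simp: rejective_sampling_def set_cond_pmf)
  then have "measure_pmf.prob (rejective_sampling K p S) E
      = (\<Sum>I | I \<in> Pow {1..K} \<and> I \<in> E. pmf (rejective_sampling K p S) I)"
    by (rule prob_supported) simp
  also have "\<dots> = (\<Sum>I | I \<in> Pow {1..K} \<and> I \<in> {I. card I = S \<and> I \<in> E}.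
      pmf ?M I / measure_pmf.prob ?M {I. card I = S})"
    by (intro sum.mono_neutral_cong_right) (auto simp: pmf)
  also have "\<dots> = measure_pmf.prob ?M {I. card I = S \<and> I \<in> E} / measure_pmf.prob ?M {I. card I = S}"
    by (subst prob_supported[OF set_pmf_poisson_sampling[of K p], of "{I. card I = S \<and> I \<in> E}"])
      (simp_all add: sum_divide_distrib)
  finally show ?thesis .
qed

text \<open>Source of the constant 2: the complementary event has probability
  \<open>lower_tail\<close> at the integer mean.\<close>

lemma poisson_sampling_median:
  assumes p: "\<And>i. i \<in> {1..K} \<Longrightarrow> p i \<in> {0..1}" and "(\<Sum>i=1..K. p i) = real S"
  shows "1 / 2 \<le> measure_pmf.prob (poisson_sampling K p) {I. S \<le> card I}"
proof -
  let ?M = "poisson_sampling K p"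
  have prob: "measure_pmf.prob ?M E = (\<Sum>I | I \<subseteq> {1..K} \<and> I \<in> E. weight {1..K} p I)" for E
    using p by (rule prob_poisson_sampling)
  have "measure_pmf.prob ?M {I. card I < S} = lower_tail {1..K} p (int S)"
    unfolding prob lower_tail_def by (intro sum.mono_neutral_cong_left) auto
  also have "\<dots> \<le> 1 / 2" using assms by (intro lower_tail_integer_mean) auto
  finally have "measure_pmf.prob ?M {I. card I < S} \<le> 1 / 2" .
  moreover have "measure_pmf.prob ?M {I. S \<le> card I} = 1 - measure_pmf.prob ?M {I. card I < S}"
    using measure_pmf.prob_compl[of "{I. card I < S}" ?M] by (simp add: Compl_eq not_less flip: Compl_eq_Diff_UNIV)
  ultimately show ?thesis by simp
qed

theorem lemma7:
  fixes K S :: nat and p :: "nat \<Rightarrow> real" and f :: "nat set \<Rightarrow> nat"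
  assumes "\<And>i. i \<in> {1..K} \<Longrightarrow> p i \<in> {0..1}"
    and "S > 0"
    and "(\<Sum>i=1..K. p i) = real S"
    and "f \<in> Pow {1..K} \<rightarrow> {0, 1}"
    and "\<And>I J. I \<in> Pow {1..K} \<Longrightarrow> J \<in> Pow {1..K} \<Longrightarrow> I \<subseteq> J \<Longrightarrow> f I \<le> f J"
  shows "measure_pmf.prob (rejective_sampling K p S) {I. f I = 1}
    \<le> 2 * measure_pmf.prob (poisson_sampling K p) {I. f I = 1}"
proof -
  let ?P = "measure_pmf.prob (poisson_sampling K p)"
  have up: "f J = 1" if "I \<subseteq> J" "J \<subseteq> {1..K}" "f I = 1" for I J
  proof -
    have "f I \<le> f J" using assms(5)[of I J] that by auto
    moreover have "f J \<in> {0, 1}" using assms(4) that by auto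
    ultimately show ?thesis using that by auto
  qed
  have prob: "?P E = (\<Sum>I | I \<subseteq> {1..K} \<and> I \<in> E. weight {1..K} p I)" for E
    by (rule prob_poisson_sampling) (rule assms(1))
  have Z: "0 < ?P {I. card I = S}"
    using rejective_sampling_well_defined[OF assms(1,3)] by (auto intro: measure_pmf_posI)
  have "?P {I. card I = S \<and> f I = 1} * (1 / 2) \<le> ?P {I. card I = S \<and> f I = 1} * ?P {I. S \<le> card I}"
    using poisson_sampling_median[OF assms(1,3)] by (intro mult_left_mono) auto
  \<comment> \<open>The exchange inequality with \<open>k = S\<close> and the increasing event
    \<open>f I = 1\<close>.\<close>
  also have "\<dots> \<le> ?P {I. card I = S} * ?P {I. S \<le> card I \<and> f I = 1}"
    unfolding prob mem_Collect_eq
    using assms(1) up by (intro weight_exchange) auto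
  \<comment> \<open>Dropping the size restriction only enlarges the event.\<close>
  also have "\<dots> \<le> ?P {I. card I = S} * ?P {I. f I = 1}"
    by (intro mult_left_mono measure_pmf.finite_measure_mono) auto
  finally have "?P {I. card I = S \<and> f I = 1} \<le> 2 * ?P {I. f I = 1} * ?P {I. card I = S}"
    by (simp add: mult_ac)
  then show ?thesis
    using Z prob_rejective_sampling[where p = p, OF _ assms(3), of "{I. f I = 1}"] assms(1)
    by (simp add: pos_divide_le_eq)
qed

end
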